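(* Let $f$ be the symbol of a symmetric tridiagonal $k$-Toeplitz operator. Then $$G_0\subseteq\sigma(\mathbf{B}_0)\cup\sigma(\mathbf{B}_1).$$
   Context: Let $k\ge 1$, $a_1,\dots,a_k\in\mathbb{C}$ and $b_1,\dots,b_k\in\mathbb{C}\setminus\{0\}$, extended $k$-periodically in the index. The symmetric (not necessarily Hermitian) tridiagonal $k$-Toeplitz operator $\mathbf{T}(f)$ on $\ell^2(\mathbb{N})$, $\mathbb{N}=\{1,2,\dots\}$, has matrix entries $\mathbf{T}(f)_{n,n}=a_n$, $\mathbf{T}(f)_{n,n+1}=\mathbf{T}(f)_{n+1,n}=b_n$, and all other entries zero. Its symbol is $f(z)=\mathbf{A}_{-1}z^{-1}+\mathbf{A}_0+\mathbf{A}_1z\in\mathbb{C}^{k\times k}$, $z\in\mathbb{C}\setminus\{0\}$, where $\mathbf{A}_0$ is the leading $k\times k$ block of $\mathbf{T}(f)$, $\mathbf{A}_{-1}$ has the single nonzero entry $b_k$ in position $(k,1)$, and $\mathbf{A}_1$ has the single nonzero entry $b_k$ in position $(1,k)$. $\mathbf{B}_0$ and $\mathbf{B}_1$ are the leading and the trailing $(k-1)\times(k-1)$ principal submatrices of $\mathbf{A}_0$, respectively (empty spectrum if $k=1$). For a continuous matrix function $g:\mathbb{T}\to\mathbb{C}^{k\times k}$ on the unit circle $\mathbb{T}$ with Fourier coefficients $g_n$ (so $g(z)=\sum_n g_nz^n$), $\mathbf{T}(g)$ denotes the semi-infinite block Toeplitz operator with $(i,j)$ block $g_{i-j}$. For $\lambda\in\mathbb{C}$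 let $z_1(\lambda),z_2(\lambda)$ be the two roots of the quadratic polynomial $z\det(f(z)-\lambda\,\mathrm{Id})$ in $z$; $\Gamma=\{\lambda\in\mathbb{C}:|z_1(\lambda)|=|z_2(\lambda)|\}$. For $\lambda\in\mathbb{C}\setminus\Gamma$ set $$C_0(\lambda)=\det\Big(\mathbf{T}\big((f-\lambda\,\mathrm{Id})^{-1}\big)\,\mathbf{T}(f-\lambda\,\mathrm{Id})\Big)$$ (a Fredholm determinant of identity plus a trace-class operator), and $G_0=\{\lambda\in\mathbb{C}\setminus\Gamma:C_0(\lambda)=0\}$. *)

theory Defs
  imports
    "HOL-Analysis.Infinite_Sum"
    "HOL-Analysis.Henstock_Kurzweil_Integration"
    "Jordan_Normal_Form.Spectral_Radius"
begin

section \<open>Tridiagonal Toeplitz operators and their symbols\<close>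

text \<open>
  All indices start at 0: \<^term>\<open>a n\<close> and \<^term>\<open>b n\<close> stand for the entries
  usually written with index n + 1. In particular \<^term>\<open>b (k - 1)\<close> is the last off-diagonal
  entry of the period.
\<close>

definition tridiag_entry :: "(nat \<Rightarrow> complex) \<Rightarrow> (nat \<Rightarrow> complex) \<Rightarrow> nat \<Rightarrow> nat \<Rightarrow> complex" where
  "tridiag_entry a b m n =
     (if m = n then a m else if n = Suc m then b m else if m = Suc n then b n else 0)"

definition A_zero :: "nat \<Rightarrow> (nat \<Rightarrow> complex) \<Rightarrow> (nat \<Rightarrow> complex) \<Rightarrow> complex mat" where
  "A_zero k a b = mat k k (\<lambda>(i, j). tridiag_entry a b i j)"

definition A_minus :: "nat \<Rightarrow> (nat \<Rightarrow> complex) \<Rightarrow> complex mat" where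
  "A_minus k b = mat k k (\<lambda>(i, j). if i = k - 1 \<and> j = 0 then b (k - 1) else 0)"

definition A_plus :: "nat \<Rightarrow> (nat \<Rightarrow> complex) \<Rightarrow> complex mat" where
  "A_plus k b = mat k k (\<lambda>(i, j). if i = 0 \<and> j = k - 1 then b (k - 1) else 0)"

definition tridiag_symbol ::
  "nat \<Rightarrow> (nat \<Rightarrow> complex) \<Rightarrow> (nat \<Rightarrow> complex) \<Rightarrow> complex \<Rightarrow> complex mat" where
  "tridiag_symbol k a b z = inverse z \<cdot>\<^sub>m A_minus k b + A_zero k a b + z \<cdot>\<^sub>m A_plus k b"

definition B_zero :: "nat \<Rightarrow> (nat \<Rightarrow> complex) \<Rightarrow> (nat \<Rightarrow> complex) \<Rightarrow> complex mat" where
  "B_zero k a b = mat (k - 1) (k - 1) (\<lambda>(i, j). A_zero k a b $$ (i, j))"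

definition B_one :: "nat \<Rightarrow> (nat \<Rightarrow> complex) \<Rightarrow> (nat \<Rightarrow> complex) \<Rightarrow> complex mat" where
  "B_one k a b = mat (k - 1) (k - 1) (\<lambda>(i, j). A_zero k a b $$ (Suc i, Suc j))"


section \<open>Block Toeplitz operators\<close>

definition fourier_coeff :: "nat \<Rightarrow> (complex \<Rightarrow> complex mat) \<Rightarrow> int \<Rightarrow> complex mat" where
  "fourier_coeff k g n = mat k k (\<lambda>(i, j).
     integral {0..2 * pi} (\<lambda>t. g (cis t) $$ (i, j) * cis (- real_of_int n * t)) / (2 * pi))"

text \<open>
  Sequences of vectors of length k are flattened into scalar sequences: entry p of block i
  has index i * k + p.
\<close>

definition toeplitz_entry :: "nat \<Rightarrow> (complex \<Rightarrow> complex mat) \<Rightarrow> nat \<Rightarrow> nat \<Rightarrow> complex" where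
  "toeplitz_entry k g m n =
     fourier_coeff k g (int (m div k) - int (n div k)) $$ (m mod k, n mod k)"

text \<open>
  The action of an infinite matrix on sequences. The rows of a bounded operator
  are square summable, so on square summable sequences the sums converge absolutely.
\<close>

definition toeplitz_op ::
  "nat \<Rightarrow> (complex \<Rightarrow> complex mat) \<Rightarrow> (nat \<Rightarrow> complex) \<Rightarrow> (nat \<Rightarrow> complex)" where
  "toeplitz_op k g x = (\<lambda>m. \<Sum>\<^sub>\<infinity>n. toeplitz_entry k g m n * x n)"


section \<open>Fredholm determinants\<close>

definition std_basis :: "nat \<Rightarrow> nat \<Rightarrow> complex" where
  "std_basis n = (\<lambda>i. if i = n then 1 else 0)"

definition op_entry :: "((nat \<Rightarrow> complex) \<Rightarrow> (nat \<Rightarrow> complex)) \<Rightarrow> nat \<Rightarrow> nat \<Rightarrow> complex" where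
  "op_entry L m n = L (std_basis n) m"

definition principal_minor :: "(nat \<Rightarrow> nat \<Rightarrow> complex) \<Rightarrow> nat set \<Rightarrow> complex" where
  "principal_minor K S = det (mat (card S) (card S)
     (\<lambda>(i, j). K (sorted_list_of_set S ! i) (sorted_list_of_set S ! j)))"

text \<open>
  The trace of the m-th exterior power of an operator on square summable sequences. The wedge
  products of m distinct standard basis vectors, one for each set of m indices, form an
  orthonormal basis of the exterior power, and the diagonal entries of the
  exterior power of K in this basis are the principal minors of K.
\<close>

definition trace_ext_power :: "nat \<Rightarrow> (nat \<Rightarrow> nat \<Rightarrow> complex) \<Rightarrow> complex" where
  "trace_ext_power m K = (\<Sum>\<^sub>\<infinity>S\<in>{S. finite S \<and> card S = m}. principal_minor K S)"

text \<open>
  The Fredholm determinant of an operator L = 1 + K, as the sum of the traces of the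
  exterior powers of K. For K of trace class all sums converge absolutely.
\<close>

definition fredholm_det :: "((nat \<Rightarrow> complex) \<Rightarrow> (nat \<Rightarrow> complex)) \<Rightarrow> complex" where
  "fredholm_det L = (\<Sum>m. trace_ext_power m (op_entry (\<lambda>x i. L x i - x i)))"


section \<open>The sets associated with a symbol\<close>

definition shifted_symbol ::
  "nat \<Rightarrow> (complex \<Rightarrow> complex mat) \<Rightarrow> complex \<Rightarrow> complex \<Rightarrow> complex mat" where
  "shifted_symbol k f l z = f z - l \<cdot>\<^sub>m 1\<^sub>m k"

text \<open>
  The symbol is only meaningful for nonzero z, but infinitely many values
  determine the polynomial p uniquely. The roots are counted with multiplicity.
\<close>

definition Gamma_set :: "nat \<Rightarrow> (complex \<Rightarrow> complex mat) \<Rightarrow> complex set" where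
  "Gamma_set k f = {l. \<exists>p z1 z2.
     (\<forall>z. z \<noteq> 0 \<longrightarrow> poly p z = z * det (shifted_symbol k f l z)) \<and>
     proots p = {#z1, z2#} \<and> cmod z1 = cmod z2}"

text \<open>
  Outside of \<^term>\<open>Gamma_set k f\<close>, with f a tridiagonal symbol, the two roots have product 1
  and hence do not lie on the unit circle, so the inverse exists at every point of it.
\<close>

definition C_zero :: "nat \<Rightarrow> (complex \<Rightarrow> complex mat) \<Rightarrow> complex \<Rightarrow> complex" where
  "C_zero k f l = fredholm_det
     (toeplitz_op k (\<lambda>z. the (mat_inverse (shifted_symbol k f l z)))
      \<circ> toeplitz_op k (shifted_symbol k f l))"

definition G_zero :: "nat \<Rightarrow> (complex \<Rightarrow> complex mat) \<Rightarrow> complex set" where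
  "G_zero k f = {l. l \<notin> Gamma_set k f \<and> C_zero k f l = 0}"

end

(*
  T(f - l) is tridiagonal, so T((f - l)^-1) T(f - l) differs from the identity only in its first
  column, and C_0(l) = 1 - b_k r(-1), where r is row 0 of the doubly infinite inverse of f - l
  (the Fourier coefficients of (f - l)^-1, which exists on the unit circle for l outside Gamma).
  The sequence r solves the three-term recurrence with a unit source at 0 and decays in both
  directions. If C_0(l) = 0, the source is exactly cancelled by the term b_k r(-1), so that both
  halves (0, r(0), r(1), ...) and (r(0), r(-1), r(-2), ...) solve the homogeneous recurrence.
  Take the first half if r(0) is nonzero, and otherwise the second, which then starts with a zero
  as well. The Wronskian of this solution and its shift by one period is constant and decays, hence
  vanishes. So the solution has another zero one period away, and between the two zeros it is an
  eigenvector of B_0 or of B_1, respectively.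
*)
theory Submission
  imports Defs
begin

section \<open>Fourier coefficients of continuous functions\<close>

text \<open>One entry of \<open>fourier_coeff\<close>, for a function of the angle instead of a
  function on the circle.\<close>

definition scalar_fourier :: "(real \<Rightarrow> complex) \<Rightarrow> int \<Rightarrow> complex" where
  "scalar_fourier F n = integral {0..2 * pi} (\<lambda>t. F t * cis (- real_of_int n * t)) / (2 * pi)"

lemma cis_int_has_integral:
  "((\<lambda>t. cis (real_of_int n * t)) has_integral (if n = 0 then of_real (2 * pi) else 0)) {0..2 * pi}"
proof (cases "n = 0")
  case True
  then show ?thesis
    using has_integral_const_real[of "1::complex" 0 "2*pi"] by (simp add: scaleR_conv_of_real)
next
  case False
  have "((\<lambda>t. cis (real_of_int n * t)) has_integral
      (cis (real_of_int n * (2 * pi)) / (\<i> * of_int n) - cis (real_of_int n * 0) / (\<i> * of_int n))) {0..2 * pi}"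
  proof (rule fundamental_theorem_of_calculus)
    fix x :: real
    have "((\<lambda>t. cis (real_of_int n * t)) has_derivative
        (\<lambda>t. (real_of_int n * t) *\<^sub>R (\<i> * cis (real_of_int n * x)))) (at x within {0..2*pi})"
      by (rule has_derivative_cis) (auto intro!: derivative_eq_intros)
    then have "((\<lambda>t. cis (real_of_int n * t)) has_vector_derivative
        (of_int n * (\<i> * cis (real_of_int n * x)))) (at x within {0..2*pi})"
      unfolding has_vector_derivative_def by (simp add: scaleR_conv_of_real mult_ac)
    from has_vector_derivative_divide[OF this, of "\<i> * of_int n"]
    show "((\<lambda>t. cis (real_of_int n * t) / (\<i> * of_int n)) has_vector_derivative
        cis (real_of_int n * x)) (at x within {0..2 * pi})"
      using False by simp
  qed simp
  moreover have "cis (real_of_int n * (2 * pi)) = 1"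
    using cis_multiple_2pi[of "real_of_int n"] by (simp add: mult_ac)
  ultimately show ?thesis
    using False by simp
qed

lemma scalar_fourier_has_integral:
  assumes "continuous_on {0..2 * pi} F"
  shows "((\<lambda>t. F t * cis (- real_of_int n * t)) has_integral of_real (2 * pi) * scalar_fourier F n)
    {0..2 * pi}"
  unfolding scalar_fourier_def using assms
  by (auto intro!: integrable_integral integrable_continuous_real continuous_intros)

lemma scalar_fourier_eqI:
  assumes "((\<lambda>t. F t * cis (- real_of_int n * t)) has_integral of_real (2 * pi) * c) {0..2 * pi}"
  shows "scalar_fourier F n = c"
  using integral_unique[OF assms] by (simp add: scalar_fourier_def)

lemma scalar_fourier_cis: "scalar_fourier (\<lambda>t. cis (real_of_int m * t)) n = (if m = n then 1 else 0)"
proof (rule scalar_fourier_eqI)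
  have *: "cis (real_of_int m * t) * cis (- real_of_int n * t) = cis (real_of_int (m - n) * t)" for t
    by (simp add: cis_mult algebra_simps)
  show "((\<lambda>t. cis (real_of_int m * t) * cis (- real_of_int n * t)) has_integral
      of_real (2 * pi) * (if m = n then 1 else 0)) {0..2 * pi}"
    using cis_int_has_integral[of "m - n"] unfolding * by (cases "m = n") auto
qed

lemma scalar_fourier_mult_cis:
  "scalar_fourier (\<lambda>t. F t * cis (real_of_int m * t)) n = scalar_fourier F (n - m)"
proof -
  have "F t * cis (real_of_int m * t) * cis (- real_of_int n * t) =
      F t * cis (- real_of_int (n - m) * t)" for t
    by (simp add: mult.assoc cis_mult algebra_simps)
  then show ?thesis unfolding scalar_fourier_def by presburger
qed

lemma scalar_fourier_sum:
  assumes "finite A" "\<And>x. x \<in> A \<Longrightarrow> continuous_on {0..2 * pi} (F x)"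
  shows "scalar_fourier (\<lambda>t. \<Sum>x\<in>A. c x * F x t) n = (\<Sum>x\<in>A. c x * scalar_fourier (F x) n)"
proof (rule scalar_fourier_eqI)
  have "((\<lambda>t. \<Sum>x\<in>A. c x * (F x t * cis (- real_of_int n * t))) has_integral
      (\<Sum>x\<in>A. c x * (of_real (2 * pi) * scalar_fourier (F x) n))) {0..2 * pi}"
    by (intro has_integral_sum assms(1) has_integral_mult_right scalar_fourier_has_integral assms(2))
  then show "((\<lambda>t. (\<Sum>x\<in>A. c x * F x t) * cis (- real_of_int n * t)) has_integral
      of_real (2 * pi) * (\<Sum>x\<in>A. c x * scalar_fourier (F x) n)) {0..2 * pi}"
    by (simp add: sum_distrib_left sum_distrib_right mult_ac)
qed

lemma scalar_fourier_const: "scalar_fourier (\<lambda>t. c) n = (if n = 0 then c else 0)"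
  using scalar_fourier_sum[of "{()}" "\<lambda>_ t. cis (real_of_int 0 * t)" "\<lambda>_. c" n]
    scalar_fourier_cis[of 0 n] by (simp split: if_splits)

text \<open>Pythagoras: after the square is expanded, the cross term integrates to -4 \<pi> |c|^2 by
  the choice of c as the Fourier coefficient, against 2 \<pi> |c|^2 from the mode itself.\<close>

lemma L2_norm_remove_mode:
  assumes F: "continuous_on {0..2 * pi} F"
  shows "integral {0..2 * pi} (\<lambda>t. (cmod (F t - scalar_fourier F n * cis (real_of_int n * t)))\<^sup>2) =
    integral {0..2 * pi} (\<lambda>t. (cmod (F t))\<^sup>2) - 2 * pi * (cmod (scalar_fourier F n))\<^sup>2"
proof -
  let ?c = "scalar_fourier F n"
  have eq: "(cmod (F t - ?c * cis (real_of_int n * t)))\<^sup>2 =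
      (cmod (F t))\<^sup>2 + (cmod ?c)\<^sup>2 - 2 * Re (cnj ?c * (F t * cis (- real_of_int n * t)))" for t
  proof -
    have 1: "(cmod (x - y))\<^sup>2 = (cmod x)\<^sup>2 + (cmod y)\<^sup>2 - 2 * Re (cnj y * x)" for x y
      by (simp only: cmod_power2) (simp add: power2_eq_square algebra_simps)
    show ?thesis
      by (subst 1) (simp add: norm_mult cis_cnj mult_ac)
  qed
  have "((\<lambda>t. Re (cnj ?c * (F t * cis (- real_of_int n * t)))) has_integral
      Re (cnj ?c * (of_real (2 * pi) * ?c))) {0..2 * pi}"
    using has_integral_linear[OF has_integral_mult_right[OF scalar_fourier_has_integral[OF F]] bounded_linear_Re,
      of "cnj ?c" n]
    by (simp only: o_def)
  moreover have "Re (cnj ?c * (of_real (2 * pi) * ?c)) = 2 * pi * (cmod ?c)\<^sup>2"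
    by (simp only: cmod_power2) (simp add: power2_eq_square algebra_simps)
  ultimately have 2: "((\<lambda>t. Re (cnj ?c * (F t * cis (- real_of_int n * t)))) has_integral
      2 * pi * (cmod ?c)\<^sup>2) {0..2 * pi}" by simp
  have 3: "((\<lambda>t. (cmod (F t))\<^sup>2) has_integral integral {0..2 * pi} (\<lambda>t. (cmod (F t))\<^sup>2)) {0..2 * pi}"
    using F by (auto intro!: integrable_integral integrable_continuous_real continuous_intros)
  have 4: "((\<lambda>t. (cmod ?c)\<^sup>2) has_integral 2 * pi * (cmod ?c)\<^sup>2) {0..2 * pi}"
    using has_integral_const_real[of "(cmod ?c)\<^sup>2" 0 "2*pi"] by simp
  have "((\<lambda>t. (cmod (F t))\<^sup>2 + (cmod ?c)\<^sup>2 - 2 * Re (cnj ?c * (F t * cis (- real_of_int n * t))))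
      has_integral (integral {0..2 * pi} (\<lambda>t. (cmod (F t))\<^sup>2) + 2 * pi * (cmod ?c)\<^sup>2
        - 2 * (2 * pi * (cmod ?c)\<^sup>2))) {0..2 * pi}"
    by (intro has_integral_diff has_integral_add 2 3 4 has_integral_mult_right)
  from integral_unique[OF this] show ?thesis
    unfolding eq by simp
qed

text \<open>Subtracting the mode m lowers the squared norm by exactly the share of m and leaves all
  other coefficients unchanged, so the induction hypothesis applies to the remainder.\<close>

lemma bessel_inequality:
  assumes "finite N" and "continuous_on {0..2 * pi} F"
  shows "2 * pi * (\<Sum>n\<in>N. (cmod (scalar_fourier F n))\<^sup>2) \<le> integral {0..2 * pi} (\<lambda>t. (cmod (F t))\<^sup>2)"
  using assms
proof (induction N arbitrary: F rule: finite_induct)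
  case empty
  then show ?case by (auto intro!: integral_nonneg integrable_continuous_real continuous_intros)
next
  case (insert m N)
  define H where "H = (\<lambda>t. F t - scalar_fourier F m * cis (real_of_int m * t))"
  have H: "continuous_on {0..2 * pi} H"
    unfolding H_def using insert.prems by (intro continuous_intros)
  have coeff: "scalar_fourier H n = scalar_fourier F n" if "n \<in> N" for n
  proof -
    \<comment> \<open>The difference is written as a sum over a two-element index set to bring it
      into the form of \<open>scalar_fourier_sum\<close>.\<close>
    have "H = (\<lambda>t. \<Sum>x\<in>{True, False}. (if x then 1 else - scalar_fourier F m) *
        (if x then F t else cis (real_of_int m * t)))"
      by (auto simp: H_def)
    moreover have "continuous_on {0..2 * pi} (\<lambda>t. if x then F t else cis (real_of_int m * t))" for x
      using insert.prems by (cases x) (auto intro!: continuous_intros)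
    ultimately have "scalar_fourier H n = (\<Sum>x\<in>{True, False}. (if x then 1 else - scalar_fourier F m) *
        scalar_fourier (\<lambda>t. if x then F t else cis (real_of_int m * t)) n)"
      by (simp only:) (rule scalar_fourier_sum, simp_all)
    also have "\<dots> = scalar_fourier F n"
      using that insert.hyps by (auto simp: scalar_fourier_cis)
    finally show ?thesis .
  qed
  have "2 * pi * (\<Sum>n\<in>N. (cmod (scalar_fourier H n))\<^sup>2) \<le> integral {0..2 * pi} (\<lambda>t. (cmod (H t))\<^sup>2)"
    by (rule insert.IH[OF H])
  also have "\<dots> = integral {0..2 * pi} (\<lambda>t. (cmod (F t))\<^sup>2) - 2 * pi * (cmod (scalar_fourier F m))\<^sup>2"
    unfolding H_def by (rule L2_norm_remove_mode[OF insert.prems])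
  finally show ?case
    using insert.hyps coeff by (simp add: algebra_simps)
qed

section \<open>Three-term recurrences\<close>

text \<open>\<open>W\<close> is the discrete Wronskian weighted by \<beta>. The recurrence is
  symmetric, so \<open>W\<close> is constant; since \<beta> is bounded and both solutions decay,
  that constant is 0. The coefficient \<open>\<beta> i\<close> couples the sites i and i + 1,
  whereas \<open>\<alpha> i\<close> belongs to the site i + 1.\<close>

lemma decaying_solutions_proportional:
  fixes \<alpha> \<beta> \<phi> \<psi> :: "nat \<Rightarrow> complex"
  assumes \<phi>: "\<And>i. \<beta> i * \<phi> i + \<alpha> i * \<phi> (Suc i) + \<beta> (Suc i) * \<phi> (Suc (Suc i)) = 0"
    and \<psi>: "\<And>i. \<beta> i * \<psi> i + \<alpha> i * \<psi> (Suc i) + \<beta> (Suc i) * \<psi> (Suc (Suc i)) = 0"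
    and "\<phi> \<longlonglongrightarrow> 0" "\<psi> \<longlonglongrightarrow> 0" and "bounded (range \<beta>)" and "\<beta> 0 \<noteq> 0"
  shows "\<phi> 0 * \<psi> 1 = \<phi> 1 * \<psi> 0"
proof -
  define W where "W i = \<beta> i * (\<phi> i * \<psi> (Suc i) - \<phi> (Suc i) * \<psi> i)" for i
  have const: "W i = W 0" for i
  proof (induction i)
    case (Suc i)
    have "W (Suc i) = W i"
    proof -
      \<comment> \<open>Both outermost terms of \<open>W (Suc i)\<close> are eliminated by the
        recurrences; the \<alpha> terms then cancel.\<close>
      have "\<beta> (Suc i) * \<phi> (Suc (Suc i)) = - (\<beta> i * \<phi> i + \<alpha> i * \<phi> (Suc i))"
        and "\<beta> (Suc i) * \<psi> (Suc (Suc i)) = - (\<beta> i * \<psi> i + \<alpha> i * \<psi> (Suc i))"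
        using \<phi>[of i] \<psi>[of i] unfolding eq_neg_iff_add_eq_0 by (simp_all add: add_ac)
      moreover have "W (Suc i) = \<phi> (Suc i) * (\<beta> (Suc i) * \<psi> (Suc (Suc i)))
          - \<psi> (Suc i) * (\<beta> (Suc i) * \<phi> (Suc (Suc i)))"
        by (simp add: W_def algebra_simps)
      ultimately have "W (Suc i) = \<phi> (Suc i) * - (\<beta> i * \<psi> i + \<alpha> i * \<psi> (Suc i))
          - \<psi> (Suc i) * - (\<beta> i * \<phi> i + \<alpha> i * \<phi> (Suc i))"
        by (simp only:)
      then show ?thesis
        by (simp add: W_def algebra_simps)
    qed
    with Suc show ?case by simp
  qed simp
  obtain B where B: "\<And>i. cmod (\<beta> i) \<le> B"
    using \<open>bounded (range \<beta>)\<close> by (auto simp: bounded_iff)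
  have "(\<lambda>i. \<phi> i * \<psi> (Suc i) - \<phi> (Suc i) * \<psi> i) \<longlonglongrightarrow> 0 * 0 - 0 * 0"
    using assms(3,4) by (intro tendsto_intros LIMSEQ_Suc)
  then have lim: "(\<lambda>i. \<phi> i * \<psi> (Suc i) - \<phi> (Suc i) * \<psi> i) \<longlonglongrightarrow> 0" by simp
  have "W \<longlonglongrightarrow> 0"
  proof (rule Lim_null_comparison)
    show "\<forall>\<^sub>F i in sequentially. norm (W i) \<le> B * norm (\<phi> i * \<psi> (Suc i) - \<phi> (Suc i) * \<psi> i)"
      unfolding W_def norm_mult using B by (auto intro!: always_eventually mult_right_mono)
    show "(\<lambda>i. B * norm (\<phi> i * \<psi> (Suc i) - \<phi> (Suc i) * \<psi> i)) \<longlonglongrightarrow> 0"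
      using tendsto_mult_right_zero[OF tendsto_norm_zero[OF lim]] .
  qed
  moreover have "W = (\<lambda>_. W 0)" using const by blast
  ultimately have "W 0 = 0" by (metis LIMSEQ_const_iff)
  then show ?thesis using \<open>\<beta> 0 \<noteq> 0\<close> by (simp add: W_def)
qed

text \<open>Zeros at the sites 0 and d + 1 decouple the sites 1 to d from the rest of the
  recurrence, so the values there form an eigenvector of the finite section. The index i only
  witnesses that this vector is nonzero.\<close>

lemma jacobi_eigenvalueI:
  fixes \<alpha> \<beta> x :: "nat \<Rightarrow> complex"
  assumes rec: "\<And>i. i < d \<Longrightarrow> \<beta> i * x i + \<alpha> i * x (Suc i) + \<beta> (Suc i) * x (Suc (Suc i)) = l * x (Suc i)"
    and "x 0 = 0" "x (Suc d) = 0" "i < d" "x (Suc i) \<noteq> 0"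
  shows "l \<in> spectrum (mat d d (\<lambda>(i, j). tridiag_entry \<alpha> (\<lambda>n. \<beta> (Suc n)) i j))"
proof -
  define v where "v = vec d (\<lambda>i. x (Suc i))"
  have "eigenvector (mat d d (\<lambda>(i, j). tridiag_entry \<alpha> (\<lambda>n. \<beta> (Suc n)) i j)) v l"
    unfolding eigenvector_def
  proof (intro conjI eq_vecI)
    show "v \<in> carrier_vec (dim_row (mat d d (\<lambda>(i, j). tridiag_entry \<alpha> (\<lambda>n. \<beta> (Suc n)) i j)))"
      by (simp add: v_def)
    show "v \<noteq> 0\<^sub>v (dim_row (mat d d (\<lambda>(i, j). tridiag_entry \<alpha> (\<lambda>n. \<beta> (Suc n)) i j)))"
      using assms(4,5) by (auto simp: v_def vec_eq_iff)
  next
    fix m assume "m < dim_vec (l \<cdot>\<^sub>v v)"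
    then have m: "m < d" by (simp add: v_def)
    have "(\<Sum>j<d. tridiag_entry \<alpha> (\<lambda>n. \<beta> (Suc n)) m j * x (Suc j)) =
        (\<Sum>j<d. (if j = m then \<alpha> m * x (Suc m) else 0) +
          ((if j = Suc m then \<beta> (Suc m) * x (Suc (Suc m)) else 0) +
          (if Suc j = m then \<beta> m * x m else 0)))"
      by (rule sum.cong) (auto simp: tridiag_entry_def)
    also have "\<dots> = \<alpha> m * x (Suc m) + (\<Sum>j<d. if j = Suc m then \<beta> (Suc m) * x (Suc (Suc m)) else 0)
        + (\<Sum>j<d. if Suc j = m then \<beta> m * x m else 0)"
      using m by (simp add: sum.distrib)
    \<comment> \<open>The last row has no superdiagonal entry, but the missing term would carry the
      factor \<open>x (Suc d) = 0\<close>; the first row is saved in the same way by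
      \<open>x 0 = 0\<close>.\<close>
    also have "(\<Sum>j<d. if j = Suc m then \<beta> (Suc m) * x (Suc (Suc m)) else 0) = \<beta> (Suc m) * x (Suc (Suc m))"
      using m assms(3) by (cases "Suc m = d") auto
    also have "(\<Sum>j<d. if Suc j = m then \<beta> m * x m else 0) = \<beta> m * x m"
      using m assms(2) by (cases m) auto
    finally show "(mat d d (\<lambda>(i, j). tridiag_entry \<alpha> (\<lambda>n. \<beta> (Suc n)) i j) *\<^sub>v v) $ m = (l \<cdot>\<^sub>v v) $ m"
      using m rec[OF m] by (simp add: v_def scalar_prod_def lessThan_atLeast0 algebra_simps)
  qed (simp add: v_def)
  then show ?thesis by (auto simp: spectrum_def eigenvalue_def)
qed

section \<open>Determinants, inverses and Fredholm determinants\<close>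

text \<open>Laplace expansion along row p: its cofactors do not see the changed entry. This isolates
  the dependence of the determinant of the symbol on z.\<close>

lemma det_add_entry:
  fixes A B :: "'a :: comm_ring_1 mat"
  assumes A: "A \<in> carrier_mat n n" and B: "B \<in> carrier_mat n n" and pq: "p < n" "q < n"
    and eq: "\<And>i j. i < n \<Longrightarrow> j < n \<Longrightarrow> B $$ (i, j) = A $$ (i, j) + (if i = p \<and> j = q then x else 0)"
  shows "det B = det A + x * cofactor A p q"
proof -
  have cof: "cofactor B p j = cofactor A p j" if "j < n" for j
  proof -
    have "mat_delete B p j = mat_delete A p j"
      using A B pq that by (intro eq_matI) (auto simp: mat_delete_def eq)
    then show ?thesis by (simp add: cofactor_def)
  qed
  have "det B = (\<Sum>j<n. B $$ (p, j) * cofactor B p j)"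
    by (rule laplace_expansion_row[OF B pq(1)])
  also have "\<dots> = (\<Sum>j<n. A $$ (p, j) * cofactor A p j + (if j = q then x * cofactor A p q else 0))"
    using pq by (intro sum.cong) (auto simp: cof eq algebra_simps)
  also have "\<dots> = det A + x * cofactor A p q"
    using pq by (simp add: sum.distrib laplace_expansion_row[OF A pq(1)])
  finally show ?thesis .
qed

text \<open>The scaled adjugate shows that A is a unit of the matrix ring, so
  \<open>mat_inverse\<close> succeeds, and inverses are unique. The explicit formula is what makes
  continuity of the inverse symbol accessible.\<close>

lemma the_mat_inverse_eq_adj_mat:
  fixes A :: "'a :: field mat"
  assumes A: "A \<in> carrier_mat n n" and "det A \<noteq> 0"
  shows "the (mat_inverse A) * A = 1\<^sub>m n" and "the (mat_inverse A) = (1 / det A) \<cdot>\<^sub>m adj_mat A"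
proof -
  let ?C = "(1 / det A) \<cdot>\<^sub>m adj_mat A"
  note adj = adj_mat[OF A]
  have C: "?C \<in> carrier_mat n n" using adj(1) by simp
  have AC: "A * ?C = 1\<^sub>m n" 
    using mult_smult_distrib[OF A adj(1)] adj(2) assms(2) by (auto intro!: eq_matI)
  have CA: "?C * A = 1\<^sub>m n"
    using mult_smult_assoc_mat[OF adj(1) A] adj(3) assms(2) by (auto intro!: eq_matI)
  have "A \<in> Units (ring_mat TYPE('a) n ())"
    using A C AC CA by (auto simp: Units_def ring_mat_def)
  then obtain B where inv: "mat_inverse A = Some B"
    using mat_inverse(1)[OF A, of "()"] by fastforce
  note B = mat_inverse(2)[OF A inv]
  have "B = B * (A * ?C)" using B by (simp only: AC right_mult_one_mat[of B n n])
  also have "\<dots> = (B * A) * ?C" using assoc_mult_mat[of B n n A n ?C n] A B C by simp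
  also have "\<dots> = ?C" using B left_mult_one_mat[OF C] by simp
  finally have "B = ?C" .
  then show "the (mat_inverse A) * A = 1\<^sub>m n" "the (mat_inverse A) = ?C" 
    using inv B by simp_all
qed

lemma continuous_on_det:
  fixes M :: "'t :: topological_space \<Rightarrow> complex mat"
  assumes "\<And>t. t \<in> T \<Longrightarrow> M t \<in> carrier_mat n n"
    and "\<And>i j. i < n \<Longrightarrow> j < n \<Longrightarrow> continuous_on T (\<lambda>t. M t $$ (i, j))"
  shows "continuous_on T (\<lambda>t. det (M t))"
proof -
  have "continuous_on T (\<lambda>t. \<Sum>p | p permutes {0..<n}. signof p * (\<Prod>i = 0..<n. M t $$ (i, p i)))"
  proof (intro continuous_intros assms(2))
    fix p i assume "p \<in> {p. p permutes {0..<n}}" "i \<in> {0..<n}"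
    then show "p i < n" using permutes_in_image[of p "{0..<n}" i] by simp
  qed simp
  then show ?thesis
    by (rule continuous_on_eq) (simp add: det_def'[OF assms(1)])
qed

lemma continuous_on_adj_mat:
  fixes M :: "'t :: topological_space \<Rightarrow> complex mat"
  assumes M: "\<And>t. t \<in> T \<Longrightarrow> M t \<in> carrier_mat n n"
    and cont: "\<And>i j. i < n \<Longrightarrow> j < n \<Longrightarrow> continuous_on T (\<lambda>t. M t $$ (i, j))"
    and "p < n" "q < n"
  shows "continuous_on T (\<lambda>t. adj_mat (M t) $$ (p, q))"
proof -
  \<comment> \<open>The (p, q) entry of the adjugate is the cofactor at (q, p), hence the swapped
    indices.\<close>
  define D where "D t = mat_delete (M t) q p" for t
  have D: "D t \<in> carrier_mat (n - 1) (n - 1)" if "t \<in> T" for t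
    unfolding D_def by (rule mat_delete_carrier[OF M[OF that]])
  have "continuous_on T (\<lambda>t. D t $$ (i, j))" if "i < n - 1" "j < n - 1" for i j
  proof -
    have "continuous_on T (\<lambda>t. M t $$ (if i < q then i else Suc i, if j < p then j else Suc j))"
      by (rule cont) (use that in auto)
    then show ?thesis
      by (rule continuous_on_eq) (use that in \<open>auto simp: D_def mat_delete_def carrier_matD[OF M]\<close>)
  qed
  with D have "continuous_on T (\<lambda>t. (-1) ^ (q + p) * det (D t))"
    by (intro continuous_intros continuous_on_det)
  then show ?thesis
    by (rule continuous_on_eq)
      (use assms(3,4) in \<open>auto simp: adj_mat_def cofactor_def D_def carrier_matD[OF M]\<close>)
qed

lemma infsum_std_basis: "(\<Sum>\<^sub>\<infinity>i. f i * std_basis n i) = f n"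
proof -
  have "(\<Sum>\<^sub>\<infinity>i. f i * std_basis n i) = (\<Sum>\<^sub>\<infinity>i\<in>{n}. f i * std_basis n i)"
    by (rule infsum_cong_neutral) (auto simp: std_basis_def)
  then show ?thesis by (simp add: std_basis_def)
qed

text \<open>A principal minor of a matrix supported in column 0 vanishes as soon as its index set
  contains a nonzero index. Only the empty set and {0} contribute.\<close>

lemma fredholm_det_single_column:
  assumes K: "\<And>m n. op_entry (\<lambda>x i. L x i - x i) m n = (if n = 0 then \<kappa> m else 0)"
  shows "fredholm_det L = 1 + \<kappa> 0"
proof -
  let ?K = "op_entry (\<lambda>x i. L x i - x i)"
  have 0: "trace_ext_power 0 ?K = 1"
  proof -
    have "{S :: nat set. finite S \<and> card S = 0} = {{}}" by auto
    then show ?thesis by (simp add: trace_ext_power_def principal_minor_def det_dim_zero)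
  qed
  have 1: "trace_ext_power 1 ?K = \<kappa> 0"
  proof -
    have single: "principal_minor ?K {n} = ?K n n" for n
      by (simp add: principal_minor_def det_single)
    have "trace_ext_power 1 ?K = (\<Sum>\<^sub>\<infinity>S\<in>{{0}}. principal_minor ?K S)"
      unfolding trace_ext_power_def
    proof (rule infsum_cong_neutral)
      fix S :: "nat set" assume "S \<in> {S. finite S \<and> card S = 1} - {{0}}"
      then obtain n where "S = {n}" "n \<noteq> 0" by (auto simp: card_1_singleton_iff)
      then show "principal_minor ?K S = 0" by (simp add: single K)
    qed auto
    then show ?thesis by (simp add: single K del: One_nat_def)
  qed
  have 2: "trace_ext_power m ?K = 0" if m: "m \<ge> 2" for m
    unfolding trace_ext_power_def
  proof (rule infsum_0)
    fix S :: "nat set" assume "S \<in> {S. finite S \<and> card S = m}"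
    then have S: "finite S" "card S = m" by auto
    let ?s = "sorted_list_of_set S"
    \<comment> \<open>The second smallest index of S is positive, so column 1 of the minor is zero
      and the expansion along it gives 0.\<close>
    have "?s ! 0 < ?s ! 1"
      using S m sorted_wrt_nth_less[OF strict_sorted_list_of_set[of S], of 0 1] by simp
    then have ne: "?s ! 1 \<noteq> 0" by simp
    have "principal_minor ?K S = (\<Sum>i<card S. 0)"
      unfolding principal_minor_def
      by (subst laplace_expansion_column[of _ "card S" 1]) (use S m ne in \<open>auto simp: K\<close>)
    then show "principal_minor ?K S = 0" by simp
  qed
  have "fredholm_det L = (\<Sum>m\<in>{0, 1}. trace_ext_power m ?K)"
    unfolding fredholm_det_def
  proof (rule suminf_finite)
    fix m :: nat assume "m \<notin> {0, 1}"
    then show "trace_ext_power m ?K = 0" by (intro 2) auto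
  qed simp
  then show ?thesis by (simp add: 0 1[simplified])
qed

section \<open>The symbol and its inverse\<close>

lemma atLeastAtMost_neighbours: "{n - 1..n + 1} = {n - 1, n, n + 1 :: int}"
  by auto

lemma B_zero_B_one_eq:
  "B_zero k a b = mat (k - 1) (k - 1) (\<lambda>(i, j). tridiag_entry a b i j)"
  "B_one k a b = mat (k - 1) (k - 1) (\<lambda>(i, j). tridiag_entry (\<lambda>n. a (Suc n)) (\<lambda>n. b (Suc n)) i j)"
  by (auto simp: B_zero_def B_one_def A_zero_def tridiag_entry_def intro!: eq_matI)

locale periodic_tridiagonal =
  fixes k :: nat and a b :: "nat \<Rightarrow> complex"
  assumes k: "k \<ge> 1"
    and a_periodic: "\<And>n. a (n + k) = a n"
    and b_periodic: "\<And>n. b (n + k) = b n"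
    and b_nonzero: "\<And>n. b n \<noteq> 0"
begin

abbreviation h :: "complex \<Rightarrow> complex \<Rightarrow> complex mat" where
  "h l z \<equiv> shifted_symbol k (tridiag_symbol k a b) l z"

lemma h_carrier: "h l z \<in> carrier_mat k k"
  by (intro carrier_matI) (simp_all add: shifted_symbol_def tridiag_symbol_def A_minus_def A_zero_def A_plus_def)

lemma h_entry:
  assumes "i < k" "j < k"
  shows "h l z $$ (i, j) = tridiag_entry a b i j - (if i = j then l else 0)
    + (if i = 0 \<and> j = k - 1 then z * b (k - 1) else 0)
    + (if i = k - 1 \<and> j = 0 then inverse z * b (k - 1) else 0)"
  using assms by (auto simp: shifted_symbol_def tridiag_symbol_def A_minus_def A_zero_def A_plus_def)

text \<open>The variable occurs only in the two corner entries. Their cofactors at z = 0 are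
  determinants of mutually transposed matrices, so z and its inverse get the same coefficient; it is
  nonzero because one of these matrices is triangular with entries of \<open>b\<close> on its
  diagonal.\<close>

lemma det_h:
  obtains c d where "c \<noteq> 0" "\<And>z. z \<noteq> 0 \<Longrightarrow> det (h l z) = d + c * (z + inverse z)"
proof -
  \<comment> \<open>The shifted symbol without its lower left corner; the two corners are restored
    one after the other.\<close>
  define R where "R z = mat k k (\<lambda>(i, j). tridiag_entry a b i j - (if i = j then l else 0)
    + (if i = 0 \<and> j = k - 1 then z * b (k - 1) else 0))" for z
  have R: "R z \<in> carrier_mat k k" for z by (simp add: R_def)
  have 1: "det (h l z) = det (R z) + inverse z * b (k - 1) * cofactor (R z) (k - 1) 0" for z
    by (rule det_add_entry[OF R h_carrier]) (use k in \<open>auto simp: h_entry R_def\<close>)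
  have 2: "det (R z) = det (R 0) + z * b (k - 1) * cofactor (R 0) 0 (k - 1)" for z
    by (rule det_add_entry[OF R R]) (use k in \<open>auto simp: R_def\<close>)
  define D where "D z = mat_delete (R z) (k - 1) 0" for z
  have D: "D z \<in> carrier_mat (k - 1) (k - 1)" for z
    unfolding D_def by (rule mat_delete_carrier[OF R])
  \<comment> \<open>At most one entry of \<open>D z\<close> depends on z, the former upper right
    corner. The resulting term linear in z meets the factor \<open>inverse z\<close> and only adds
    to the constant d.\<close>
  have "\<exists>m. \<forall>z. det (D z) = det (D 0) + z * m"
  proof (cases "k = 1")
    case True
    then have "det (D z) = 1" for z using D[of z] by simp
    then show ?thesis by (intro exI[of _ 0]) simp
  next
    case False
    have "det (D z) = det (D 0) + z * b (k - 1) * cofactor (D 0) 0 (k - 2)" for z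
      by (rule det_add_entry[OF D D])
        (use k False in \<open>auto simp: D_def R_def mat_delete_def\<close>)
    then show ?thesis by (metis mult.assoc)
  qed
  then obtain m where m: "\<And>z. det (D z) = det (D 0) + z * m" by blast
  define E where "E = mat_delete (R 0) 0 (k - 1)"
  have E: "E \<in> carrier_mat (k - 1) (k - 1)"
    unfolding E_def by (rule mat_delete_carrier[OF R])
  have E_entry: "E $$ (i, j) = tridiag_entry a b (Suc i) j - (if Suc i = j then l else 0)"
    if "i < k - 1" "j < k - 1" for i j
    using that by (auto simp: E_def mat_delete_def R_def)
  have "D 0 = transpose_mat E"
    by (rule eq_matI) (auto simp: D_def E_def mat_delete_def R_def tridiag_entry_def)
  then have D0: "det (D 0) = det E"
    using det_transpose[OF E] by simp
  have "upper_triangular E"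
    using E by (auto simp: E_entry tridiag_entry_def)
  then have "det E = prod_list (diag_mat E)"
    by (rule det_upper_triangular[OF _ E])
  moreover have "0 \<notin> set (diag_mat E)"
    using E by (auto simp: diag_mat_def E_entry tridiag_entry_def b_nonzero)
  ultimately have nz: "det E \<noteq> 0"
    by (simp add: prod_list_zero_iff)
  define e where "e = (-1 :: complex) ^ (k - 1)"
  show thesis
  proof (rule that)
    show "b (k - 1) * e * det E \<noteq> 0"
      using nz by (simp add: b_nonzero e_def)
    show "det (h l z) = (det (R 0) + b (k - 1) * e * m) + b (k - 1) * e * det E * (z + inverse z)"
      if "z \<noteq> 0" for z
    proof -
      have "cofactor (R 0) 0 (k - 1) = e * det E"
        by (simp add: cofactor_def E_def e_def)
      moreover have "cofactor (R z) (k - 1) 0 = e * (det E + z * m)"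
        using m[of z] D0 by (simp add: cofactor_def D_def e_def)
      ultimately show ?thesis
        using that 1[of z] 2[of z] by (simp add: algebra_simps)
    qed
  qed
qed

text \<open>By the symmetry of the determinant under inversion of z, a root z on the circle comes
  with the root 1/z. Both have modulus 1, which would put \<open>l\<close> into \<Gamma>.\<close>

lemma det_h_nonzero:
  assumes l: "l \<notin> Gamma_set k (tridiag_symbol k a b)" and z: "cmod z = 1"
  shows "det (h l z) \<noteq> 0"
proof
  assume 0: "det (h l z) = 0"
  obtain c d where c: "c \<noteq> 0" and det: "\<And>z. z \<noteq> 0 \<Longrightarrow> det (h l z) = d + c * (z + inverse z)"
    by (rule det_h[of l]) auto
  have z0: "z \<noteq> 0" using z by auto
  with 0 det[of z] have d: "d = - c * (z + inverse z)" by (simp add: eq_neg_iff_add_eq_0)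
  \<comment> \<open>With d determined by the root, w (d + c (w + 1/w)) factors as c (w - z) (w -
    1/z). This also covers z = 1/z, a double root.\<close>
  let ?p = "Polynomial.smult c ([:- z, 1:] * [:- inverse z, 1:])"
  have "poly ?p w = w * det (h l w)" if "w \<noteq> 0" for w
    using that z0 by (simp add: det d field_simps)
  moreover have "proots ?p = {#z, inverse z#}"
    using c by (simp add: proots_mult del: mult_pCons_left mult_pCons_right)
  moreover have "cmod z = cmod (inverse z)"
    using z by (simp add: norm_inverse)
  ultimately have "l \<in> Gamma_set k (tridiag_symbol k a b)"
    unfolding Gamma_set_def by blast
  with l show False by simp
qed

section \<open>Periodic continuation of the coefficients to all integers\<close>

definition a_ext :: "int \<Rightarrow> complex" where "a_ext j = a (nat (j mod int k))"
definition b_ext :: "int \<Rightarrow> complex" where "b_ext j = b (nat (j mod int k))"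

lemma a_mod: "a (n mod k) = a n"
proof -
  have "a (m + k * q) = a m" for m q
    by (induction q) (simp_all add: a_periodic flip: add.assoc, metis a_periodic add.commute add.left_commute)
  from this[of "n mod k" "n div k"] show ?thesis by simp
qed

lemma b_mod: "b (n mod k) = b n"
proof -
  have "b (m + k * q) = b m" for m q
    by (induction q) (simp_all add: b_periodic flip: add.assoc, metis b_periodic add.commute add.left_commute)
  from this[of "n mod k" "n div k"] show ?thesis by simp
qed

lemma a_ext_nat: "a_ext (int n) = a n" and b_ext_nat: "b_ext (int n) = b n"
  by (simp_all add: a_ext_def b_ext_def a_mod b_mod flip: of_nat_mod)

lemma a_ext_add_k: "a_ext (j + int k) = a_ext j" and b_ext_add_k: "b_ext (j + int k) = b_ext j"
  by (simp_all add: a_ext_def b_ext_def)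

lemma b_ext_nonzero: "b_ext j \<noteq> 0"
  by (simp add: b_ext_def b_nonzero)

lemma nat_mod_less_k: "nat (n mod int k) < k"
  using k by (simp add: nat_less_iff)

lemma int_eq_iff_div_mod: "m = n \<longleftrightarrow> nat (m mod int k) = nat (n mod int k) \<and> m div int k = n div int k"
proof
  assume *: "nat (m mod int k) = nat (n mod int k) \<and> m div int k = n div int k"
  then have "m mod int k = n mod int k" using k by (simp add: eq_nat_nat_iff)
  with * show "m = n" by (metis div_mult_mod_eq)
qed simp

lemma bounded_range_b_ext: "bounded (range b_ext)"
proof -
  have "range b_ext \<subseteq> b ` {..<k}" by (auto simp: b_ext_def nat_mod_less_k)
  then show ?thesis by (meson bounded_subset finite_imp_bounded finite_imageI finite_lessThan)
qed

end

section \<open>The inverse symbol and the doubly infinite Laurent matrix\<close>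

locale tridiagonal_resolvent = periodic_tridiagonal +
  fixes l :: complex
  assumes l: "l \<notin> Gamma_set k (tridiag_symbol k a b)"
begin

definition g :: "complex \<Rightarrow> complex mat" where
  "g z = the (mat_inverse (h l z))"

lemma g_mult_h: "cmod z = 1 \<Longrightarrow> g z * h l z = 1\<^sub>m k"
  unfolding g_def by (rule the_mat_inverse_eq_adj_mat(1)[OF h_carrier det_h_nonzero[OF l]])

lemma g_eq: "cmod z = 1 \<Longrightarrow> g z = (1 / det (h l z)) \<cdot>\<^sub>m adj_mat (h l z)"
  unfolding g_def by (rule the_mat_inverse_eq_adj_mat(2)[OF h_carrier det_h_nonzero[OF l]])

lemma g_carrier: "cmod z = 1 \<Longrightarrow> g z \<in> carrier_mat k k"
  by (simp add: g_eq adj_mat(1)[OF h_carrier])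

text \<open>By Cramer's rule an entry is a cofactor divided by the determinant, which has no zero on
  the circle for \<open>l\<close> outside \<Gamma>.\<close>

lemma continuous_g:
  assumes "p < k" "q < k"
  shows "continuous_on T (\<lambda>t. g (cis t) $$ (p, q))"
proof -
  have entry: "continuous_on T (\<lambda>t. h l (cis t) $$ (i, j))" if "i < k" "j < k" for i j
  proof -
    have "continuous_on T (\<lambda>t. tridiag_entry a b i j - (if i = j then l else 0)
      + (if i = 0 \<and> j = k - 1 then 1 else 0) * (cis t * b (k - 1))
      + (if i = k - 1 \<and> j = 0 then 1 else 0) * (inverse (cis t) * b (k - 1)))"
      by (intro continuous_intros) auto
    then show ?thesis
      by (rule continuous_on_eq) (use that in \<open>auto simp: h_entry\<close>)
  qed
  have "continuous_on T (\<lambda>t. adj_mat (h l (cis t)) $$ (p, q) / det (h l (cis t)))"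
    using assms det_h_nonzero[OF l]
    by (intro continuous_intros continuous_on_adj_mat[OF h_carrier] continuous_on_det[OF h_carrier] entry)
      auto
  then show ?thesis
    by (rule continuous_on_eq) (use assms in \<open>simp add: g_eq carrier_matD[OF adj_mat(1)[OF h_carrier]]\<close>)
qed

text \<open>The doubly infinite Laurent matrix of \<open>h l\<close>, flattened to scalar
  indices.\<close>

definition jacobi :: "int \<Rightarrow> int \<Rightarrow> complex" where
  "jacobi i j = (if i = j then a_ext i - l else if j = i + 1 then b_ext i else if i = j + 1 then b_ext j else 0)"

text \<open>Column n of the Laurent matrix lives on n - 1, n, n + 1. The residue of such an index is
  a row of the symbol, and its block offset from n is a Fourier mode. Summing over the neighbours
  also handles k = 1 and k = 2, where several of them share a residue.\<close>

lemma h_cis_column: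
  assumes q: "q < k"
  shows "h l (cis t) $$ (q, nat (n mod int k)) =
    (\<Sum>j\<in>{n - 1..n + 1}. (if nat (j mod int k) = q then jacobi j n else 0) *
      cis (real_of_int (j div int k - n div int k) * t))"
proof -
  define s where "s = nat (n mod int k)"
  define N where "N = n div int k"
  have s: "s < k" using k by (simp add: s_def nat_less_iff)
  define K where "K = k - 1"
  have K: "k - 1 = K" and sK: "s \<le> K" and qK: "q \<le> K" using s q by (auto simp: K_def)
  have n: "n = int k * N + int s"
    using k by (simp add: s_def N_def)
  have nd: "n div int k = N" "nat (n mod int k) = s" by (simp_all add: N_def s_def)
  \<comment> \<open>A neighbour lies in another block only if n is at the edge of its own: the
    predecessor for s = 0, the successor for s = k - 1.\<close>
  have prev: "(n - 1) div int k = (if s = 0 then N - 1 else N) \<and>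
      (n - 1) mod int k = (if s = 0 then int k - 1 else int s - 1)"
  proof (cases "s = 0")
    case True
    then have e: "n - 1 = int k * (N - 1) + (int k - 1)" by (simp add: n algebra_simps)
    show ?thesis
      using int_div_pos_eq[OF e] int_mod_pos_eq[OF e] k True by simp
  next
    case False
    then have e: "n - 1 = int k * N + (int s - 1)" by (simp add: n)
    show ?thesis
      using int_div_pos_eq[OF e] int_mod_pos_eq[OF e] s False by simp
  qed
  have succ: "(n + 1) div int k = (if s = k - 1 then N + 1 else N) \<and>
      (n + 1) mod int k = (if s = k - 1 then 0 else int s + 1)"
  proof (cases "s = k - 1")
    case True
    then have e: "n + 1 = int k * (N + 1) + 0" using k by (simp add: n algebra_simps of_nat_diff)
    show ?thesis
      using int_div_pos_eq[OF e] int_mod_pos_eq[OF e] k True by simp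
  next
    case False
    then have e: "n + 1 = int k * N + (int s + 1)" by (simp add: n)
    show ?thesis
      using int_div_pos_eq[OF e] int_mod_pos_eq[OF e] s False by simp
  qed
  have bp: "jacobi (n - 1) n = b (if s = 0 then k - 1 else s - 1)"
    using prev k by (auto simp: jacobi_def b_ext_def nat_diff_distrib')
  have bn: "jacobi (n + 1) n = b s" and an: "jacobi n n = a s - l"
    by (auto simp: jacobi_def b_ext_def a_ext_def s_def)
  have mp: "nat ((n - 1) mod int k) = (if s = 0 then k - 1 else s - 1)"
    using prev k by (auto simp: nat_diff_distrib')
  have ms: "nat ((n + 1) mod int k) = (if s = k - 1 then 0 else Suc s)"
    using succ by (auto simp: nat_add_distrib)
  have dp: "(n - 1) div int k - N = (if s = 0 then -1 else 0)" using prev by simp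
  have ds: "(n + 1) div int k - N = (if s = k - 1 then 1 else 0)" using succ by simp
  have rhs: "(\<Sum>j\<in>{n - 1..n + 1}. (if nat (j mod int k) = q then jacobi j n else 0) *
      cis (real_of_int (j div int k - N) * t)) =
    (if nat ((n - 1) mod int k) = q then jacobi (n - 1) n else 0) * cis (real_of_int ((n - 1) div int k - N) * t)
    + (if s = q then jacobi n n else 0)
    + (if nat ((n + 1) mod int k) = q then jacobi (n + 1) n else 0) * cis (real_of_int ((n + 1) div int k - N) * t)"
    unfolding atLeastAtMost_neighbours by (simp add: nd)
  have nbr: "q = s \<or> q = Suc s \<or> s = Suc q \<or> q \<noteq> s \<and> q \<noteq> Suc s \<and> s \<noteq> Suc q" by blast
  show ?thesis
    unfolding nd rhs h_entry[OF q s] unfolding mp ms dp ds bp bn an K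
    by ((insert nbr sK qK, elim disjE); cases "s = 0"; cases "s = K") (auto simp: tridiag_entry_def)
qed

section \<open>The product of the Toeplitz operators\<close>

text \<open>The entries of the inverse of the doubly infinite Laurent matrix with symbol \<^term>\<open>h l\<close>.\<close>

definition G :: "int \<Rightarrow> int \<Rightarrow> complex" where
  "G m j = scalar_fourier (\<lambda>t. g (cis t) $$ (nat (m mod int k), nat (j mod int k)))
    (m div int k - j div int k)"

text \<open>This is one Fourier coefficient of one entry of the pointwise identity
  \<open>g z * h l z = 1\<close>. The modes from \<open>h l\<close> shift the coefficients of
  \<open>g\<close>, which turns them into the entries \<open>G m j\<close>.\<close>

lemma G_recurrence:
  "(\<Sum>j\<in>{n - 1..n + 1}. jacobi j n * G m j) = (if m = n then 1 else 0)"
proof -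
  define p where "p = nat (m mod int k)"
  define s where "s = nat (n mod int k)"
  define N where "N = m div int k - n div int k"
  define F where "F j = (\<lambda>t. g (cis t) $$ (p, nat (j mod int k)) * cis (real_of_int (j div int k - n div int k) * t))"
    for j
  have ps: "p < k" "s < k" by (simp_all add: p_def s_def nat_mod_less_k)
  have F: "continuous_on {0..2 * pi} (F j)" for j
    unfolding F_def by (intro continuous_intros continuous_g ps nat_mod_less_k)
  have FG: "scalar_fourier (F j) N = G m j" for j
    unfolding F_def scalar_fourier_mult_cis by (simp add: G_def N_def p_def)
  have inverse_entry: "(if p = s then 1 else 0) = (\<Sum>j\<in>{n - 1..n + 1}. jacobi j n * F j t)" for t
  proof -
    have "(if p = s then 1 else 0) = (g (cis t) * h l (cis t)) $$ (p, s)"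
      using ps by (simp add: g_mult_h)
    also have "\<dots> = (\<Sum>q<k. g (cis t) $$ (p, q) * h l (cis t) $$ (q, s))"
      using ps g_carrier[of "cis t"] h_carrier[of l "cis t"]
      by (simp add: scalar_prod_def lessThan_atLeast0)
    \<comment> \<open>Each neighbour j contributes to exactly one q, its residue, so the sum over q
      collapses after the exchange.\<close>
    also have "\<dots> = (\<Sum>q<k. \<Sum>j\<in>{n - 1..n + 1}. if q = nat (j mod int k) then jacobi j n * F j t else 0)"
      by (intro sum.cong refl) (auto simp: h_cis_column s_def F_def sum_distrib_left mult_ac intro!: sum.cong)
    also have "\<dots> = (\<Sum>j\<in>{n - 1..n + 1}. \<Sum>q<k. if q = nat (j mod int k) then jacobi j n * F j t else 0)"
      by (rule sum.swap)
    also have "\<dots> = (\<Sum>j\<in>{n - 1..n + 1}. jacobi j n * F j t)"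
      by (simp add: nat_mod_less_k)
    finally show ?thesis .
  qed
  have "(\<Sum>j\<in>{n - 1..n + 1}. jacobi j n * scalar_fourier (F j) N) =
      scalar_fourier (\<lambda>t. \<Sum>j\<in>{n - 1..n + 1}. jacobi j n * F j t) N"
    by (rule scalar_fourier_sum[symmetric]) (simp_all add: F)
  also have "\<dots> = scalar_fourier (\<lambda>t. if p = s then 1 else 0) N"
    by (simp only: inverse_entry[symmetric])
  also have "\<dots> = (if m = n then 1 else 0)"
    by (auto simp: scalar_fourier_const int_eq_iff_div_mod[of m n] p_def s_def N_def)
  finally show ?thesis
    by (simp only: FG)
qed

text \<open>Row m consists of the Fourier coefficients of the k functions in one row of
  \<open>g\<close>, and an injective sequence meets each of them at most once; Bessel's inequality
  bounds the partial sums. Arbitrary injective \<open>s\<close> covers both directions along the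
  row.\<close>

lemma G_square_summable: "inj s \<Longrightarrow> summable (\<lambda>i. (cmod (G m (s i)))\<^sup>2)"
proof -
  assume s: "inj s"
  define p where "p = nat (m mod int k)"
  define F where "F q = (\<lambda>t. g (cis t) $$ (p, q))" for q
  define e where "e j = (nat (j mod int k), m div int k - j div int k)" for j
  have p: "p < k" by (simp add: p_def nat_mod_less_k)
  have F: "continuous_on {0..2 * pi} (F q)" if "q < k" for q
    unfolding F_def by (intro continuous_g p that)
  have G: "G m j = (case e j of (q, N) \<Rightarrow> scalar_fourier (F q) N)" for j
    by (simp add: G_def e_def F_def p_def)
  have fst_e: "fst (e j) < k" for j
    by (simp add: e_def nat_mod_less_k)
  have "i = j" if "e i = e j" for i j
    using that by (simp add: e_def int_eq_iff_div_mod[of i j])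
  then have inj: "inj (\<lambda>i. e (s i))"
    using s by (auto intro!: injI dest: injD)
  show "summable (\<lambda>i. (cmod (G m (s i)))\<^sup>2)"
  proof (rule summableI_nonneg_bounded)
    fix n
    let ?I = "(\<lambda>i. e (s i)) ` {..<n}"
    have "(\<Sum>i<n. (cmod (G m (s i)))\<^sup>2) = (\<Sum>(q, N)\<in>?I. (cmod (scalar_fourier (F q) N))\<^sup>2)"
      using sum.reindex[OF inj_on_subset[OF inj subset_UNIV],
          of "\<lambda>(q, N). (cmod (scalar_fourier (F q) N))\<^sup>2" "{..<n}"]
      by (simp add: G split_beta)
    \<comment> \<open>Enlarging the index set to a rectangle separates q from N, so that Bessel
      applies for each q.\<close>
    also have "\<dots> \<le> (\<Sum>(q, N)\<in>{..<k} \<times> snd ` ?I. (cmod (scalar_fourier (F q) N))\<^sup>2)"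
    proof (rule sum_mono2)
      show "?I \<subseteq> {..<k} \<times> snd ` ?I"
      proof
        fix x assume x: "x \<in> ?I"
        then have "fst x < k" using fst_e by fastforce
        with x show "x \<in> {..<k} \<times> snd ` ?I" unfolding mem_Times_iff by simp
      qed
    qed auto
    also have "\<dots> = (\<Sum>q<k. \<Sum>N\<in>snd ` ?I. (cmod (scalar_fourier (F q) N))\<^sup>2)"
      by (simp add: sum.cartesian_product)
    also have "\<dots> \<le> (\<Sum>q<k. integral {0..2 * pi} (\<lambda>t. (cmod (F q t))\<^sup>2) / (2 * pi))"
      using bessel_inequality[OF _ F] by (intro sum_mono) (simp add: field_simps)
    finally show "(\<Sum>i<n. (cmod (G m (s i)))\<^sup>2) \<le>
      (\<Sum>q<k. integral {0..2 * pi} (\<lambda>t. (cmod (F q t))\<^sup>2) / (2 * pi))" .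
  qed simp
qed

lemma G_tendsto_0: "inj s \<Longrightarrow> (\<lambda>i. G m (s i)) \<longlonglongrightarrow> 0"
proof -
  assume "inj s"
  then have "(\<lambda>i. (cmod (G m (s i)))\<^sup>2) \<longlonglongrightarrow> 0"
    by (intro summable_LIMSEQ_zero G_square_summable)
  from tendsto_real_sqrt[OF this] show ?thesis
    by (simp add: tendsto_norm_zero_iff)
qed

section \<open>The product of the one-sided operators and its Fredholm determinant\<close>

lemma toeplitz_entry_g: "toeplitz_entry k g m n = G (int m) (int n)"
  using k by (simp add: toeplitz_entry_def fourier_coeff_def G_def scalar_fourier_def
      flip: of_nat_mod of_nat_div)

text \<open>Among the neighbours of n, the row of the symbol fixes the residue and the Fourier mode
  fixes the block, so only j = m survives.\<close>

lemma toeplitz_entry_h: "toeplitz_entry k (h l) m n = jacobi (int m) (int n)"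
proof -
  define N where "N = int m div int k - int n div int k"
  define c where "c j = (if nat (j mod int k) = m mod k then jacobi j (int n) else 0)" for j
  have col: "h l (cis t) $$ (m mod k, nat (int n mod int k)) = (\<Sum>j\<in>{int n - 1..int n + 1}. c j *
      cis (real_of_int (j div int k - int n div int k) * t))" for t
    unfolding c_def by (rule h_cis_column) (use k in simp)
  have "toeplitz_entry k (h l) m n = scalar_fourier (\<lambda>t. h l (cis t) $$ (m mod k, nat (int n mod int k))) N"
    using k by (simp add: toeplitz_entry_def fourier_coeff_def scalar_fourier_def N_def
      flip: of_nat_mod of_nat_div)
  also have "\<dots> = scalar_fourier (\<lambda>t. \<Sum>j\<in>{int n - 1..int n + 1}. c j *
      cis (real_of_int (j div int k - int n div int k) * t)) N"
    by (simp only: col)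
  also have "\<dots> = (\<Sum>j\<in>{int n - 1..int n + 1}. c j * (if j div int k - int n div int k = N then 1 else 0))"
    by (subst scalar_fourier_sum, simp, intro continuous_intros, simp only: scalar_fourier_cis)
  also have "\<dots> = (\<Sum>j\<in>{int n - 1..int n + 1}. if j = int m then jacobi (int m) (int n) else 0)"
  proof (rule sum.cong)
    fix j
    have "nat (int m mod int k) = m mod k" by (simp flip: of_nat_mod)
    then show "c j * (if j div int k - int n div int k = N then 1 else 0) =
        (if j = int m then jacobi (int m) (int n) else 0)"
      using int_eq_iff_div_mod[of j "int m"] by (auto simp: c_def N_def)
  qed simp
  also have "\<dots> = jacobi (int m) (int n)"
    by (auto simp: jacobi_def)
  finally show ?thesis .
qed

text \<open>The sum over j \<ge> 0 differs from the two-sided identity \<open>G_recurrence\<close>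
  only by the neighbour -1, which occurs in column 0 alone.\<close>

lemma toeplitz_product_std_basis:
  "toeplitz_op k g (toeplitz_op k (h l) (std_basis n)) m =
    (if m = n then 1 else 0) - (if n = 0 then b_ext (-1) * G (int m) (-1) else 0)"
proof -
  define S where "S = {j. int j \<in> {int n - 1..int n + 1}}"
  have S: "S = (if n = 0 then {0, 1} else {n - 1, n, n + 1})"
    by (auto simp: S_def)
  have "toeplitz_op k g (toeplitz_op k (h l) (std_basis n)) m =
      (\<Sum>\<^sub>\<infinity>j. jacobi (int j) (int n) * G (int m) (int j))"
    by (simp add: toeplitz_op_def toeplitz_entry_h toeplitz_entry_g infsum_std_basis) (simp add: mult.commute)
  also have "\<dots> = (\<Sum>\<^sub>\<infinity>j\<in>S. jacobi (int j) (int n) * G (int m) (int j))"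
    by (rule infsum_cong_neutral) (auto simp: S_def jacobi_def)
  also have "\<dots> = (\<Sum>j\<in>S. jacobi (int j) (int n) * G (int m) (int j))"
    by (rule infsum_finite) (simp add: S)
  also have "\<dots> = (\<Sum>j\<in>{int n - 1..int n + 1}. jacobi j (int n) * G (int m) j)
      - (if n = 0 then b_ext (-1) * G (int m) (-1) else 0)"
    unfolding atLeastAtMost_neighbours by (cases n) (simp_all add: S jacobi_def)
  finally show ?thesis
    by (simp add: G_recurrence)
qed

lemma C_zero_eq: "C_zero k (tridiag_symbol k a b) l = 1 - b_ext (-1) * G 0 (-1)"
proof -
  have "C_zero k (tridiag_symbol k a b) l = fredholm_det (toeplitz_op k g \<circ> toeplitz_op k (h l))"
    by (simp add: C_zero_def g_def[abs_def])
  also have "\<dots> = 1 + - (b_ext (-1) * G (int 0) (-1))"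
    by (rule fredholm_det_single_column)
      (simp add: op_entry_def toeplitz_product_std_basis, simp add: std_basis_def)
  finally show ?thesis by simp
qed

section \<open>From a zero of C_0 to an eigenvector\<close>

lemma row_equation:
  "b_ext (j - 1) * G m (j - 1) + (a_ext j - l) * G m j + b_ext j * G m (j + 1) = (if m = j then 1 else 0)"
proof -
  have "(\<Sum>i\<in>{j - 1..j + 1}. jacobi i j * G m i) =
      b_ext (j - 1) * G m (j - 1) + (a_ext j - l) * G m j + b_ext j * G m (j + 1)"
    unfolding atLeastAtMost_neighbours by (simp add: jacobi_def)
  then show ?thesis
    using G_recurrence[of j m] by simp
qed

lemma C_zero_eq_0_imp_spectrum:
  assumes "C_zero k (tridiag_symbol k a b) l = 0"
  shows "l \<in> spectrum (B_zero k a b) \<union> spectrum (B_one k a b)"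
proof -
  define r where "r = G 0"
  have source: "b_ext (-1) * r (-1) = 1"
    using assms C_zero_eq by (simp add: r_def)
  have eq: "b_ext (j - 1) * r (j - 1) + (a_ext j - l) * r j + b_ext j * r (j + 1) = (if j = 0 then 1 else 0)" for j
    using row_equation[of j 0] by (auto simp: r_def)
  have bmk: "bounded (range (\<lambda>i::nat. b_ext (f i)))" for f
    by (rule bounded_subset[OF bounded_range_b_ext]) auto
  show ?thesis
  proof (cases "r 0 = 0")
    case False
    \<comment> \<open>The right half, shifted by one site: the value r(-1) is replaced by 0, which
      removes exactly the term that balances the source at site 0.\<close>
    define x where "x i = (if i = 0 then 0 else r (int i - 1))" for i
    define \<beta> where "\<beta> i = b_ext (int i - 1)" for i
    have rec: "\<beta> i * x i + (a_ext (int i) - l) * x (Suc i) + \<beta> (Suc i) * x (Suc (Suc i)) = 0" for i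
      using eq[of "int i"] source by (cases i) (simp_all add: x_def \<beta>_def algebra_simps)
    have per: "\<beta> (i + k) = \<beta> i" "a_ext (int (i + k)) = a_ext (int i)" for i
      using b_ext_add_k[of "int i - 1"] a_ext_add_k[of "int i"] by (simp_all add: \<beta>_def algebra_simps)
    have \<beta>0: "\<beta> 0 \<noteq> 0" by (simp add: \<beta>_def b_ext_nonzero)
    have lim: "x \<longlonglongrightarrow> 0"
      by (rule LIMSEQ_imp_Suc) (simp add: x_def r_def G_tendsto_0 inj_def)
    \<comment> \<open>By periodicity the shift by k solves the same recurrence. Since
      \<open>x 0 = 0\<close> and \<open>x 1 = r 0\<close> is nonzero, \<open>x k = 0\<close>
      follows; this also excludes k = 1.\<close>
    have "x 0 * x (1 + k) = x 1 * x (0 + k)"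
    proof (rule decaying_solutions_proportional[where \<psi> = "\<lambda>i. x (i + k)" and \<alpha> = "\<lambda>i. a_ext (int i) - l"])
      show "\<beta> i * x (i + k) + (a_ext (int i) - l) * x (Suc i + k) + \<beta> (Suc i) * x (Suc (Suc i) + k) = 0" for i
        using rec[of "i + k"] per[of i] per(1)[of "Suc i"] by simp
      show "bounded (range \<beta>)" unfolding \<beta>_def by (rule bmk)
      show "(\<lambda>i. x (i + k)) \<longlonglongrightarrow> 0" by (rule LIMSEQ_ignore_initial_segment[OF lim])
    qed (simp_all add: rec lim \<beta>0)
    then have xk: "x k = 0" using False by (simp add: x_def)
    then have k2: "k \<noteq> 1" using False by (auto simp: x_def)
    \<comment> \<open>The zeros \<open>x 0\<close> and \<open>x k\<close> enclose r(0), ..., r(k -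
      2), the sites of \<open>B_zero\<close>.\<close>
    have "l \<in> spectrum (mat (k - 1) (k - 1) (\<lambda>(i, j). tridiag_entry (\<lambda>i. a_ext (int i)) (\<lambda>n. \<beta> (Suc n)) i j))"
    proof (rule jacobi_eigenvalueI[where x = x and i = 0])
      show "\<beta> i * x i + a_ext (int i) * x (Suc i) + \<beta> (Suc i) * x (Suc (Suc i)) = l * x (Suc i)" for i
        using rec[of i] by (simp add: algebra_simps)
    qed (use k k2 xk False in \<open>auto simp: x_def\<close>)
    then show ?thesis
      by (simp add: B_zero_B_one_eq \<beta>_def a_ext_nat b_ext_nat)
  next
    case True
    \<comment> \<open>The left half, read towards minus infinity. Its recurrence is the row equation
      at -i - 1, which never meets the source at 0.\<close>
    define x where "x i = r (- int i)" for i
    define \<beta> where "\<beta> i = b_ext (- int i - 1)" for i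
    define \<alpha> where "\<alpha> i = a_ext (- int i - 1) - l" for i
    have rec: "\<beta> i * x i + \<alpha> i * x (Suc i) + \<beta> (Suc i) * x (Suc (Suc i)) = 0" for i
    proof -
      have "x (Suc i) = r (- int i - 1)" "x (Suc (Suc i)) = r (- int i - 1 - 1)"
        and "\<beta> (Suc i) = b_ext (- int i - 1 - 1)"
        unfolding x_def \<beta>_def by (rule arg_cong[of _ _ r] arg_cong[of _ _ b_ext], simp)+
      then show ?thesis
        using eq[of "- int i - 1"] by (simp add: x_def \<alpha>_def \<beta>_def add_ac)
    qed
    have per: "\<beta> (i + k) = \<beta> i" "\<alpha> (i + k) = \<alpha> i" for i
    proof -
      have "- int (i + k) - 1 + int k = - int i - 1" by simp
      then show "\<beta> (i + k) = \<beta> i" "\<alpha> (i + k) = \<alpha> i"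
        using b_ext_add_k[of "- int (i + k) - 1"] a_ext_add_k[of "- int (i + k) - 1"]
        by (simp_all only: \<alpha>_def \<beta>_def)
    qed
    have \<beta>0: "\<beta> 0 \<noteq> 0" by (simp add: \<beta>_def b_ext_nonzero)
    have lim: "x \<longlonglongrightarrow> 0"
      by (simp add: x_def[abs_def] r_def G_tendsto_0 inj_def)
    have "x 0 * x (1 + k) = x 1 * x (0 + k)"
    proof (rule decaying_solutions_proportional[where \<psi> = "\<lambda>i. x (i + k)" and \<alpha> = \<alpha>])
      show "\<beta> i * x (i + k) + \<alpha> i * x (Suc i + k) + \<beta> (Suc i) * x (Suc (Suc i) + k) = 0" for i
        using rec[of "i + k"] per[of i] per(1)[of "Suc i"] by simp
      show "bounded (range \<beta>)" unfolding \<beta>_def by (rule bmk)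
      show "(\<lambda>i. x (i + k)) \<longlonglongrightarrow> 0" by (rule LIMSEQ_ignore_initial_segment[OF lim])
    qed (simp_all add: rec lim \<beta>0)
    \<comment> \<open>Here \<open>x 1 = r (-1)\<close>, which is nonzero because its product with
      \<open>b_ext (-1)\<close> is 1.\<close>
    moreover have x1: "x 1 \<noteq> 0" using source by (auto simp: x_def)
    ultimately have xk: "x k = 0" using True by (simp add: x_def)
    then have k2: "k \<noteq> 1" using x1 by auto
    \<comment> \<open>The segment from the zero r(-k) to the zero r(0), read in increasing order.
      Its inner sites have residues 1, ..., k - 1, those of \<open>B_one\<close>.\<close>
    define y where "y i = r (int i - int k)" for i
    have bk: "b_ext (j - int k) = b_ext j" "a_ext (j - int k) = a_ext j" for j
      using b_ext_add_k[of "j - int k"] a_ext_add_k[of "j - int k"] by simp_all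
    have "l \<in> spectrum (mat (k - 1) (k - 1)
        (\<lambda>(i, j). tridiag_entry (\<lambda>i. a_ext (int (Suc i))) (\<lambda>n. b_ext (int (Suc n))) i j))"
    \<comment> \<open>The index k - 2 points to \<open>y (k - 1) = r (-1)\<close>, the value known
      to be nonzero.\<close>
    proof (rule jacobi_eigenvalueI[where x = y and i = "k - 2" and \<beta> = "\<lambda>i. b_ext (int i)"])
      show "b_ext (int i) * y i + a_ext (int (Suc i)) * y (Suc i) + b_ext (int (Suc i)) * y (Suc (Suc i)) = l * y (Suc i)"
        if "i < k - 1" for i
        using eq[of "int (Suc i) - int k"] bk[of "int (Suc i)"] bk(1)[of "int i"] that
        by (simp add: y_def algebra_simps)
    qed (use k k2 xk x1 True in \<open>auto simp: x_def y_def of_nat_diff numeral_2_eq_2\<close>)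
    then show ?thesis
      by (simp only: B_zero_B_one_eq a_ext_nat b_ext_nat) simp
  qed
qed

end

theorem theorem2p7:
  fixes k :: nat and a b :: "nat \<Rightarrow> complex"
  assumes "k \<ge> 1"
    and "\<And>n. a (n + k) = a n"
    and "\<And>n. b (n + k) = b n"
    and "\<And>n. b n \<noteq> 0"
  shows "G_zero k (tridiag_symbol k a b) \<subseteq> spectrum (B_zero k a b) \<union> spectrum (B_one k a b)"
proof
  fix l assume "l \<in> G_zero k (tridiag_symbol k a b)"
  then have G: "l \<notin> Gamma_set k (tridiag_symbol k a b)" "C_zero k (tridiag_symbol k a b) l = 0"
    by (simp_all add: G_zero_def)
  interpret tridiagonal_resolvent k a b l
    by unfold_locales (use assms G in auto)
  show "l \<in> spectrum (B_zero k a b) \<union> spectrum (B_one k a b)"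
    using G(2) by (rule C_zero_eq_0_imp_spectrum)
qed

end
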